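(* Let $H$ be a separable complex Hilbert space and let $B(H)$ be the C$^*$-algebra of all bounded linear operators on $H$. Then every (not necessarily linear nor continuous) weak-2-local $^*$-derivation $\Delta: B(H)\to B(H)$ is linear and is a $^*$-derivation.
   Context: A derivation on a C$^*$-algebra $A$ is a linear map $D:A\to A$ with $D(ab)=D(a)b+aD(b)$; it is a $^*$-derivation if moreover $D(a^* )=D(a)^*$ for all $a$. A (not necessarily linear) map $\Delta:A\to A$ is a weak-2-local $^*$-derivation if for every $a,b\in A$ and every $\phi\in A^*$ there exists a $^*$-derivation $D_{a,b,\phi}:A\to A$ (depending on $a,b,\phi$) such that $\phi\Delta(a)=\phi D_{a,b,\phi}(a)$ and $\phi\Delta(b)=\phi D_{a,b,\phi}(b)$. *)

theory Defs
  imports Complex_Main "HOL-Library.Countable_Set"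
begin

text \<open>A complex Hilbert space is modelled explicitly: an additive group 'h together with
  a scalar multiplication sc by complex numbers and an inner product ip (linear in the
  first argument, conjugate-linear in the second), complete for the induced norm.
  HOL-Analysis only provides real inner product spaces, hence this explicit rendering.\<close>

definition hnorm :: "('h \<Rightarrow> 'h \<Rightarrow> complex) \<Rightarrow> 'h \<Rightarrow> real" where
  "hnorm ip x = sqrt (Re (ip x x))"

definition complex_hilbert_space ::
  "(complex \<Rightarrow> 'h::ab_group_add \<Rightarrow> 'h) \<Rightarrow> ('h \<Rightarrow> 'h \<Rightarrow> complex) \<Rightarrow> bool" where
  "complex_hilbert_space sc ip \<longleftrightarrow>
     (\<forall>a x y. sc a (x + y) = sc a x + sc a y) \<and>
     (\<forall>a b x. sc (a + b) x = sc a x + sc b x) \<and>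
     (\<forall>a b x. sc a (sc b x) = sc (a * b) x) \<and>
     (\<forall>x. sc 1 x = x) \<and>
     (\<forall>x y. ip x y = cnj (ip y x)) \<and>
     (\<forall>x y z. ip (x + y) z = ip x z + ip y z) \<and>
     (\<forall>a x y. ip (sc a x) y = a * ip x y) \<and>
     (\<forall>x. 0 \<le> Re (ip x x)) \<and>
     (\<forall>x. ip x x = 0 \<longrightarrow> x = 0) \<and>
     (\<forall>f :: nat \<Rightarrow> 'h.
        (\<forall>e>0. \<exists>N. \<forall>m n. N \<le> m \<and> N \<le> n \<longrightarrow> hnorm ip (f m - f n) < e) \<longrightarrow>
        (\<exists>l. (\<lambda>n. hnorm ip (f n - l)) \<longlonglongrightarrow> 0))"

definition hseparable :: "('h::ab_group_add \<Rightarrow> 'h \<Rightarrow> complex) \<Rightarrow> bool" where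
  "hseparable ip \<longleftrightarrow> (\<exists>D. countable D \<and> (\<forall>x e. e > 0 \<longrightarrow> (\<exists>d\<in>D. hnorm ip (x - d) < e)))"

definition BH :: "(complex \<Rightarrow> 'h::ab_group_add \<Rightarrow> 'h) \<Rightarrow> ('h \<Rightarrow> 'h \<Rightarrow> complex) \<Rightarrow> ('h \<Rightarrow> 'h) set" where
  "BH sc ip = {T. (\<forall>x y. T (x + y) = T x + T y) \<and> (\<forall>a x. T (sc a x) = sc a (T x)) \<and>
                  (\<exists>K. \<forall>x. hnorm ip (T x) \<le> K * hnorm ip x)}"

definition opnorm :: "('h \<Rightarrow> 'h \<Rightarrow> complex) \<Rightarrow> ('h \<Rightarrow> 'h) \<Rightarrow> real" where
  "opnorm ip T = Sup {hnorm ip (T x) | x. hnorm ip x \<le> 1}"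

text \<open>Adjoint T* (exists and is unique for T in B(H), by Riesz).\<close>
definition adj :: "(complex \<Rightarrow> 'h::ab_group_add \<Rightarrow> 'h) \<Rightarrow> ('h \<Rightarrow> 'h \<Rightarrow> complex) \<Rightarrow> ('h \<Rightarrow> 'h) \<Rightarrow> ('h \<Rightarrow> 'h)" where
  "adj sc ip T = (SOME S. S \<in> BH sc ip \<and> (\<forall>x y. ip (T x) y = ip x (S y)))"

definition opadd :: "('h::ab_group_add \<Rightarrow> 'h) \<Rightarrow> ('h \<Rightarrow> 'h) \<Rightarrow> ('h \<Rightarrow> 'h)" where
  "opadd T S = (\<lambda>x. T x + S x)"

definition opscale :: "(complex \<Rightarrow> 'h \<Rightarrow> 'h) \<Rightarrow> complex \<Rightarrow> ('h \<Rightarrow> 'h) \<Rightarrow> ('h \<Rightarrow> 'h)" where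
  "opscale sc a T = (\<lambda>x. sc a (T x))"

definition opmult :: "('h \<Rightarrow> 'h) \<Rightarrow> ('h \<Rightarrow> 'h) \<Rightarrow> ('h \<Rightarrow> 'h)" where
  "opmult T S = (\<lambda>x. T (S x))"

definition BH_dual :: "(complex \<Rightarrow> 'h::ab_group_add \<Rightarrow> 'h) \<Rightarrow> ('h \<Rightarrow> 'h \<Rightarrow> complex) \<Rightarrow> (('h \<Rightarrow> 'h) \<Rightarrow> complex) set" where
  "BH_dual sc ip = {\<phi>. (\<forall>T\<in>BH sc ip. \<forall>S\<in>BH sc ip. \<phi> (opadd T S) = \<phi> T + \<phi> S) \<and>
                        (\<forall>a. \<forall>T\<in>BH sc ip. \<phi> (opscale sc a T) = a * \<phi> T) \<and>
                        (\<exists>K. \<forall>T\<in>BH sc ip. norm (\<phi> T) \<le> K * opnorm ip T)}"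

definition linear_on_BH :: "(complex \<Rightarrow> 'h::ab_group_add \<Rightarrow> 'h) \<Rightarrow> ('h \<Rightarrow> 'h \<Rightarrow> complex) \<Rightarrow> (('h \<Rightarrow> 'h) \<Rightarrow> ('h \<Rightarrow> 'h)) \<Rightarrow> bool" where
  "linear_on_BH sc ip D \<longleftrightarrow>
     (\<forall>T\<in>BH sc ip. \<forall>S\<in>BH sc ip. D (opadd T S) = opadd (D T) (D S)) \<and>
     (\<forall>a. \<forall>T\<in>BH sc ip. D (opscale sc a T) = opscale sc a (D T))"

definition star_derivation :: "(complex \<Rightarrow> 'h::ab_group_add \<Rightarrow> 'h) \<Rightarrow> ('h \<Rightarrow> 'h \<Rightarrow> complex) \<Rightarrow> (('h \<Rightarrow> 'h) \<Rightarrow> ('h \<Rightarrow> 'h)) \<Rightarrow> bool" where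
  "star_derivation sc ip D \<longleftrightarrow>
     D ` BH sc ip \<subseteq> BH sc ip \<and> linear_on_BH sc ip D \<and>
     (\<forall>T\<in>BH sc ip. \<forall>S\<in>BH sc ip. D (opmult T S) = opadd (opmult (D T) S) (opmult T (D S))) \<and>
     (\<forall>T\<in>BH sc ip. D (adj sc ip T) = adj sc ip (D T))"

definition weak_2_local_star_derivation :: "(complex \<Rightarrow> 'h::ab_group_add \<Rightarrow> 'h) \<Rightarrow> ('h \<Rightarrow> 'h \<Rightarrow> complex) \<Rightarrow> (('h \<Rightarrow> 'h) \<Rightarrow> ('h \<Rightarrow> 'h)) \<Rightarrow> bool" where
  "weak_2_local_star_derivation sc ip \<Delta> \<longleftrightarrow>
     \<Delta> ` BH sc ip \<subseteq> BH sc ip \<and>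
     (\<forall>a\<in>BH sc ip. \<forall>b\<in>BH sc ip. \<forall>\<phi>\<in>BH_dual sc ip. \<exists>D. star_derivation sc ip D \<and>
        \<phi> (\<Delta> a) = \<phi> (D a) \<and> \<phi> (\<Delta> b) = \<phi> (D b))"

end

theory Submission
  imports Defs
begin

text \<open>Testing \<open>\<Delta>\<close> with the functionals \<open>\<langle>\<cdot> x, x\<rangle>\<close>, which are real on self-adjoint operators, at the points
  \<open>a + \<i> b\<close> and \<open>a + b\<close> (\<open>a\<close>, \<open>b\<close> self-adjoint) shows that \<open>\<Delta>\<close> is additive; homogeneity and compatibility
  with the involution are immediate. Being locally a derivation, \<open>\<Delta>\<close> satisfies \<open>e \<Delta>(a) f = 0\<close> whenever
  \<open>e a = a f = 0\<close>, which by linearity gives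
  \<open>\<Delta>(e b f) = \<Delta>(e b) f + e \<Delta>(b f) - e \<Delta>(b) f\<close> for idempotents \<open>e\<close>, \<open>f\<close> and hence for all
  rank-one operators \<open>e\<close>, \<open>f\<close>, these being linear combinations of idempotents. The rank-one operators form
  a two-sided faithful family stable under multiplication by \<open>B(H)\<close>, so the Leibniz rule passes from them to
  \<open>B(H)\<close>.\<close>

section \<open>Hilbert spaces and adjoints\<close>

text \<open>First-order condition at a minimum: near \<open>t = 0\<close> the linear term dominates
  and changes sign. It serves the minimiser in \<open>riesz\<close>.\<close>

lemma linear_coeff_eq_0:
  fixes A c :: real
  assumes "A \<ge> 0" and "\<And>t. 0 \<le> t\<^sup>2 * A + 2 * t * c"
  shows "c = 0"
proof (rule ccontr)
  assume c: "c \<noteq> 0"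
  \<comment> \<open>\<open>A + 1\<close> rather than \<open>A\<close> in the denominator keeps the
    quotient meaningful when \<open>A = 0\<close>.\<close>
  define t where "t = - c / (A + 1)"
  have A: "A + 1 > 0" using assms(1) by simp
  then have ct: "c = - t * (A + 1)" unfolding t_def by simp
  have "t \<noteq> 0" using c A by (simp add: t_def)
  have "t\<^sup>2 * A + 2 * t * c = - (t\<^sup>2 * (A + 2))"
    unfolding ct by (simp add: algebra_simps power2_eq_square)
  moreover have "t\<^sup>2 * (A + 2) > 0" using \<open>t \<noteq> 0\<close> assms(1) by simp
  ultimately show False using assms(2)[of t] by linarith
qed

locale complex_hilbert =
  fixes sc :: "complex \<Rightarrow> 'h::ab_group_add \<Rightarrow> 'h"
    and ip :: "'h \<Rightarrow> 'h \<Rightarrow> complex"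
  assumes hilbert: "complex_hilbert_space sc ip"
begin

abbreviation N :: "'h \<Rightarrow> real" where "N \<equiv> hnorm ip"
abbreviation B :: "('h \<Rightarrow> 'h) set" where "B \<equiv> BH sc ip"
abbreviation star :: "('h \<Rightarrow> 'h) \<Rightarrow> 'h \<Rightarrow> 'h" where "star \<equiv> adj sc ip"
abbreviation scale :: "complex \<Rightarrow> ('h \<Rightarrow> 'h) \<Rightarrow> 'h \<Rightarrow> 'h" where "scale \<equiv> opscale sc"
notation opadd (infixl "\<oplus>" 65)
notation opmult (infixl "\<odot>" 70)

section \<open>Inner product and norm\<close>

lemma sc_add_right: "sc a (x + y) = sc a x + sc a y"
  and sc_add_left: "sc (a + b) x = sc a x + sc b x"
  and sc_sc [simp]: "sc a (sc b x) = sc (a * b) x"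
  and sc_one [simp]: "sc 1 x = x"
  and ip_commute: "ip x y = cnj (ip y x)"
  and ip_add_left: "ip (x + y) z = ip x z + ip y z"
  and ip_sc_left: "ip (sc a x) z = a * ip x z"
  and ip_self_nonneg: "0 \<le> Re (ip x x)"
  and ip_self_eq_0: "ip x x = 0 \<Longrightarrow> x = 0"
  using hilbert[unfolded complex_hilbert_space_def] by - (elim conjE, blast)+

lemma complete:
  fixes f :: "nat \<Rightarrow> 'h"
  assumes "\<And>e. e > 0 \<Longrightarrow> \<exists>M. \<forall>m n. M \<le> m \<and> M \<le> n \<longrightarrow> N (f m - f n) < e"
  shows "\<exists>l. (\<lambda>n. N (f n - l)) \<longlonglongrightarrow> 0"
  using hilbert assms unfolding complex_hilbert_space_def by blast

lemma sc_zero_left [simp]: "sc 0 x = 0"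
  using sc_add_left[of 0 0 x] by simp

lemma sc_zero_right [simp]: "sc a 0 = 0"
  using sc_add_right[of a 0 0] by simp

lemma sc_minus_left: "sc (- a) x = - sc a x"
  using sc_add_left[of "-a" a x] by (simp add: eq_neg_iff_add_eq_0)

lemma sc_minus_right: "sc a (- x) = - sc a x"
  using sc_add_right[of a "-x" x] by (simp add: eq_neg_iff_add_eq_0)

lemma sc_diff_right: "sc a (x - y) = sc a x - sc a y"
  using sc_add_right[of a x "-y"] by (simp add: sc_minus_right)

lemma ip_zero_left [simp]: "ip 0 z = 0"
  using ip_add_left[of 0 0 z] by simp

lemma ip_minus_left: "ip (- x) z = - ip x z"
  using ip_add_left[of "-x" x z] by (simp add: eq_neg_iff_add_eq_0)

lemma ip_diff_left: "ip (x - y) z = ip x z - ip y z"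
  using ip_add_left[of x "-y" z] by (simp add: ip_minus_left)

lemma ip_zero_right [simp]: "ip z 0 = 0"
  using ip_commute[of z 0] by simp

lemma ip_add_right: "ip z (x + y) = ip z x + ip z y"
  by (metis ip_commute ip_add_left complex_cnj_add)

lemma ip_diff_right: "ip z (x - y) = ip z x - ip z y"
  by (metis ip_commute ip_diff_left complex_cnj_diff)

lemma ip_sc_right: "ip z (sc a x) = cnj a * ip z x"
  by (metis ip_commute ip_sc_left complex_cnj_mult)

lemmas ip_simps = ip_add_left ip_add_right ip_diff_left ip_diff_right ip_sc_left ip_sc_right

lemma ip_right_eqI: "(\<And>z. ip z x = ip z y) \<Longrightarrow> x = y"
  using ip_self_eq_0[of "x - y"] by (simp add: ip_diff_right)

lemma ip_left_eqI: "(\<And>z. ip x z = ip y z) \<Longrightarrow> x = y"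
  using ip_self_eq_0[of "x - y"] by (simp add: ip_diff_left)

lemma N_nonneg [simp]: "0 \<le> N x"
  unfolding hnorm_def by (simp add: ip_self_nonneg)

lemma N_square: "(N x)\<^sup>2 = Re (ip x x)"
  unfolding hnorm_def by (simp add: ip_self_nonneg)

lemma Im_ip_self [simp]: "Im (ip x x) = 0"
  using ip_commute[of x x] by (metis Reals_cnj_iff complex_is_Real_iff)

lemma ip_self: "ip x x = complex_of_real ((N x)\<^sup>2)"
  by (simp add: complex_eq_iff N_square)

lemma N_eq_0: "N x = 0 \<Longrightarrow> x = 0"
  using ip_self[of x] ip_self_eq_0 by simp

lemma N_zero [simp]: "N 0 = 0"
  by (simp add: hnorm_def)

lemma N_sc: "N (sc a x) = cmod a * N x"
proof -
  have "ip (sc a x) (sc a x) = complex_of_real ((cmod a * N x)\<^sup>2)"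
    using complex_norm_square[of a]
    by (simp add: ip_simps ip_self[of x] power_mult_distrib mult.commute[of "cnj a" a])
  then have "(N (sc a x))\<^sup>2 = (cmod a * N x)\<^sup>2"
    by (simp add: N_square)
  then show ?thesis by simp
qed

lemma cauchy_schwarz: "cmod (ip x y) \<le> N x * N y"
proof (cases "y = 0")
  case False
  then have n: "N y > 0" using N_eq_0[of y] N_nonneg[of y] by linarith
  \<comment> \<open>\<open>sc c y\<close> is the orthogonal projection of \<open>x\<close> onto the
    line through \<open>y\<close>; the square norm of the remainder is nonnegative.\<close>
  define c where "c = ip x y / ip y y"
  have "ip (x - sc c y) (x - sc c y) = ip x x - ip x y * cnj (ip x y) / ip y y"
  proof -
    have "ip y y \<noteq> 0" using n by (simp add: ip_self)
    moreover have "cnj (ip y y) = ip y y" by (rule ip_commute[symmetric])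
    ultimately show ?thesis
      unfolding c_def using ip_commute[of y x] by (simp add: ip_simps field_simps)
  qed
  then have "0 \<le> (N x)\<^sup>2 - (cmod (ip x y))\<^sup>2 / (N y)\<^sup>2"
    using ip_self_nonneg[of "x - sc c y"]
    by (simp add: ip_self flip: complex_norm_square of_real_power of_real_divide of_real_diff)
  then have "(cmod (ip x y))\<^sup>2 \<le> (N x * N y)\<^sup>2"
    using n by (simp add: field_simps)
  then show ?thesis by (rule power2_le_imp_le) simp
qed simp

lemma N_triangle: "N (x + y) \<le> N x + N y"
proof (rule power2_le_imp_le)
  have "Re (ip x y) \<le> N x * N y" "Re (ip y x) \<le> N x * N y"
    using cauchy_schwarz[of x y] cauchy_schwarz[of y x] complex_Re_le_cmod[of "ip x y"]
      complex_Re_le_cmod[of "ip y x"] by (simp_all add: mult.commute)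
  then show "(N (x + y))\<^sup>2 \<le> (N x + N y)\<^sup>2"
    by (simp add: N_square ip_simps power2_sum)
qed simp

section \<open>The algebra of bounded operators\<close>

lemma BH_add: "T \<in> B \<Longrightarrow> T (x + y) = T x + T y"
  and BH_sc: "T \<in> B \<Longrightarrow> T (sc a x) = sc a (T x)"
  and BH_bounded: "T \<in> B \<Longrightarrow> \<exists>K. \<forall>x. N (T x) \<le> K * N x"
  unfolding BH_def by auto

lemma BH_I:
  assumes "\<And>x y. T (x + y) = T x + T y" "\<And>a x. T (sc a x) = sc a (T x)"
    "\<And>x. N (T x) \<le> K * N x"
  shows "T \<in> B"
  using assms unfolding BH_def by blast

lemma BH_zero [simp]: "T \<in> B \<Longrightarrow> T 0 = 0"
  using BH_add[of T 0 0] by simp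

lemma BH_diff: "T \<in> B \<Longrightarrow> T (x - y) = T x - T y"
  using BH_add[of T "x - y" y] by simp

lemma opadd_apply [simp]: "(T \<oplus> S) x = T x + S x"
  and opscale_apply [simp]: "scale a T x = sc a (T x)"
  and opmult_apply [simp]: "(T \<odot> S) x = T (S x)"
  by (simp_all add: opadd_def opscale_def opmult_def)

lemma BH_const_0 [simp]: "(\<lambda>x. 0) \<in> B"
  by (rule BH_I[where K = 0]) simp_all

lemma BH_id [simp]: "(\<lambda>x. x) \<in> B"
  by (rule BH_I[where K = 1]) simp_all

lemma BH_opadd [simp]:
  assumes "T \<in> B" "S \<in> B"
  shows "T \<oplus> S \<in> B"
proof -
  obtain K L where K: "\<And>x. N (T x) \<le> K * N x" and L: "\<And>x. N (S x) \<le> L * N x"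
    using assms BH_bounded by metis
  show ?thesis
  proof (rule BH_I[where K = "K + L"])
    fix x
    show "N ((T \<oplus> S) x) \<le> (K + L) * N x"
      using N_triangle[of "T x" "S x"] K[of x] L[of x] by (simp add: distrib_right)
  qed (simp_all add: assms BH_add BH_sc sc_add_right algebra_simps)
qed

lemma BH_opscale [simp]:
  assumes "T \<in> B"
  shows "scale a T \<in> B"
proof -
  obtain K where K: "\<And>x. N (T x) \<le> K * N x"
    using assms BH_bounded by metis
  show ?thesis
  proof (rule BH_I[where K = "cmod a * K"])
    fix x
    show "N (scale a T x) \<le> cmod a * K * N x"
      using mult_left_mono[OF K[of x], of "cmod a"] by (simp add: N_sc mult.assoc)
  qed (simp_all add: assms BH_add BH_sc sc_add_right mult.commute)
qed

lemma BH_opmult [simp]: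
  assumes "T \<in> B" "S \<in> B"
  shows "T \<odot> S \<in> B"
proof -
  obtain K L where K: "\<And>x. N (T x) \<le> K * N x" and L: "\<And>x. N (S x) \<le> L * N x"
    using assms BH_bounded by metis
  show ?thesis
  \<comment> \<open>A bound \<open>K\<close> may be negative (on the zero space), hence the absolute
    value before multiplying inequalities.\<close>
  proof (rule BH_I[where K = "\<bar>K\<bar> * L"])
    fix x
    have "N (T (S x)) \<le> \<bar>K\<bar> * N (S x)"
      using K[of "S x"] by (meson abs_ge_self mult_right_mono N_nonneg order_trans)
    also have "\<dots> \<le> \<bar>K\<bar> * (L * N x)"
      by (rule mult_left_mono[OF L]) simp
    finally show "N ((T \<odot> S) x) \<le> \<bar>K\<bar> * L * N x"
      by (simp add: mult.assoc)
  qed (simp_all add: assms BH_add BH_sc)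
qed

text \<open>The representing vector minimises \<open>\<parallel>x\<parallel>\<^sup>2 - 2 Re (f x)\<close>.\<close>
lemma riesz:
  assumes add: "\<And>x y. f (x + y) = f x + f y"
    and sc: "\<And>a x. f (sc a x) = a * f x"
    and bd: "\<And>x. cmod (f x) \<le> K * N x"
  shows "\<exists>v. \<forall>x. f x = ip x v"
proof -
  define J where "J x = (N x)\<^sup>2 - 2 * Re (f x)" for x
  have "J x \<ge> - K\<^sup>2" for x
  proof -
    have "Re (f x) \<le> K * N x"
      using bd[of x] complex_Re_le_cmod[of "f x"] by linarith
    moreover have "0 \<le> (N x - K)\<^sup>2" by simp
    ultimately show ?thesis unfolding J_def by (simp add: power2_diff algebra_simps)
  qed
  then have bdd: "bdd_below (range J)" by (auto intro: bdd_belowI[where m = "- K\<^sup>2"])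
  define m where "m = Inf (range J)"
  have m: "m \<le> J x" for x
    unfolding m_def by (rule cInf_lower[OF _ bdd]) simp
  have "\<exists>x. J x < m + 1 / Suc n" for n
    using cInf_lessD[of "range J" "m + 1 / Suc n"] unfolding m_def by auto
  then obtain X where X: "\<And>n. J (X n) < m + 1 / Suc n" by metis
  \<comment> \<open>Parallelogram law; the contributions of \<open>f\<close> cancel. As
    \<open>J\<close> is at least \<open>m\<close> at the midpoint, a minimising sequence is
    Cauchy.\<close>
  have J_parallelogram: "(N (x - y))\<^sup>2 = 2 * J x + 2 * J y - 4 * J (sc (1/2) (x + y))" for x y
    unfolding J_def N_square by (simp add: ip_simps add sc algebra_simps)
  have cauchy: "\<exists>M. \<forall>i j. M \<le> i \<and> M \<le> j \<longrightarrow> N (X i - X j) < e" if "e > 0" for e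
  proof -
    obtain M where M: "4 / e\<^sup>2 < real M" using reals_Archimedean2 by blast
    have "N (X i - X j) < e" if "M \<le> i" "M \<le> j" for i j
    proof -
      have M0: "real M > 0" using M \<open>e > 0\<close> by (smt (verit) divide_pos_pos zero_less_power)
      have "1 / real (Suc i) \<le> 1 / real M" "1 / real (Suc j) \<le> 1 / real M"
        using M0 that by (simp_all add: frac_le)
      then have "(N (X i - X j))\<^sup>2 < 4 / real M"
        using J_parallelogram[of "X i" "X j"] X[of i] X[of j] m[of "sc (1/2) (X i + X j)"]
        by linarith
      also have "\<dots> < e\<^sup>2" using M M0 \<open>e > 0\<close> by (simp add: field_simps)
      finally show ?thesis using \<open>e > 0\<close> by (simp add: power2_less_imp_less)
    qed
    then show ?thesis by blast
  qed
  obtain v where v: "(\<lambda>n. N (X n - v)) \<longlonglongrightarrow> 0"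
    using complete[OF cauchy] by blast
  have re: "Re (f h) = Re (ip h v)" for h
  proof -
    have lim: "(\<lambda>n. Re (ip (X n) h)) \<longlonglongrightarrow> Re (ip v h)"
    proof (rule LIM_zero_cancel, rule tendsto_0_le[OF v, where K = "N h"])
      have "\<bar>Re (ip (X n) h) - Re (ip v h)\<bar> \<le> N (X n - v) * N h" for n
        using cauchy_schwarz[of "X n - v" h] abs_Re_le_cmod[of "ip (X n - v) h"]
        by (simp add: ip_diff_left)
      then show "\<forall>\<^sub>F n in sequentially.
          norm (Re (ip (X n) h) - Re (ip v h)) \<le> norm (N (X n - v)) * N h"
        by simp
    qed
    \<comment> \<open>The variation is made at \<open>X n\<close>, which is minimal up to
      \<open>1 / Suc n\<close>, and only then passed to the limit; continuity of \<open>J\<close> is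
      avoided.\<close>
    have "0 \<le> t\<^sup>2 * (N h)\<^sup>2 + 2 * t * (Re (ip v h) - Re (f h))" for t
    proof -
      have "m \<le> J (X n) + (t\<^sup>2 * (N h)\<^sup>2 + 2 * t * (Re (ip (X n) h) - Re (f h)))" for n
      proof -
        have "J (X n + sc (complex_of_real t) h)
          = J (X n) + (t\<^sup>2 * (N h)\<^sup>2 + 2 * t * (Re (ip (X n) h) - Re (f h)))"
          using ip_commute[of h "X n"] unfolding J_def N_square
          by (simp add: ip_simps add sc algebra_simps power2_eq_square)
        then show ?thesis using m[of "X n + sc (complex_of_real t) h"] by simp
      qed
      then have "0 \<le> 1 / Suc n + (t\<^sup>2 * (N h)\<^sup>2 + 2 * t * (Re (ip (X n) h) - Re (f h)))" for n
        using X[of n] by (smt (verit))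
      moreover have "(\<lambda>n. 1 / Suc n + (t\<^sup>2 * (N h)\<^sup>2 + 2 * t * (Re (ip (X n) h) - Re (f h))))
        \<longlonglongrightarrow> 0 + (t\<^sup>2 * (N h)\<^sup>2 + 2 * t * (Re (ip v h) - Re (f h)))"
        using LIMSEQ_inverse_real_of_nat
        by (intro tendsto_intros lim) (simp add: inverse_eq_divide)
      ultimately have "0 \<le> 0 + (t\<^sup>2 * (N h)\<^sup>2 + 2 * t * (Re (ip v h) - Re (f h)))"
        by (intro LIMSEQ_le_const) blast+
      then show ?thesis by simp
    qed
    then have "Re (ip v h) - Re (f h) = 0"
      by (intro linear_coeff_eq_0[of "(N h)\<^sup>2"]) simp_all
    then show ?thesis using ip_commute[of h v] by simp
  qed
  \<comment> \<open>The real part at \<open>sc \<i> h\<close> is minus the imaginary part at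
    \<open>h\<close>.\<close>
  have "f h = ip h v" for h
    using re[of h] re[of "sc \<i> h"] by (simp add: complex_eq_iff sc ip_sc_left)
  then show ?thesis by blast
qed

text \<open>For fixed \<open>y\<close>, \<open>riesz\<close> represents the functional sending
  \<open>x\<close> to \<open>ip (T x) y\<close>; the representing vector is
  \<open>S y\<close>.\<close>

lemma adjoint_exists:
  assumes T: "T \<in> B"
  shows "\<exists>S\<in>B. \<forall>x y. ip (T x) y = ip x (S y)"
proof -
  obtain K where K: "\<And>x. N (T x) \<le> K * N x"
    using T BH_bounded by metis
  have "\<exists>v. \<forall>x. ip (T x) y = ip x v" for y
  proof (rule riesz[where K = "K * N y"])
    fix x
    have "cmod (ip (T x) y) \<le> N (T x) * N y" by (rule cauchy_schwarz)
    also have "\<dots> \<le> K * N x * N y" by (rule mult_right_mono[OF K]) simp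
    finally show "cmod (ip (T x) y) \<le> K * N y * N x" by (simp add: ac_simps)
  qed (simp_all add: T BH_add BH_sc ip_simps)
  then obtain S where S: "\<And>x y. ip (T x) y = ip x (S y)" by metis
  have "S \<in> B"
  proof (rule BH_I[where K = K])
    show "S (x + y) = S x + S y" for x y
      by (rule ip_right_eqI) (simp add: ip_add_right flip: S)
    show "S (sc a x) = sc a (S x)" for a x
      by (rule ip_right_eqI) (simp add: ip_sc_right flip: S)
    show "N (S y) \<le> K * N y" for y
    proof (cases "N (S y) = 0")
      case True
      then show ?thesis using K[of y] N_nonneg[of "T y"] by linarith
    next
      case False
      \<comment> \<open>Put \<open>x = S y\<close> in the adjoint relation; one factor
        \<open>N (S y)\<close> is cancelled afterwards.\<close>
      have "(N (S y))\<^sup>2 \<le> N (T (S y)) * N y"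
        using cauchy_schwarz[of "T (S y)" y] complex_Re_le_cmod[of "ip (T (S y)) y"]
        by (simp add: N_square S)
      also have "\<dots> \<le> K * N (S y) * N y"
        by (rule mult_right_mono[OF K]) simp
      finally show ?thesis
        using False N_nonneg[of "S y"] by (simp add: power2_eq_square mult.commute mult.left_commute)
    qed
  qed
  then show ?thesis using S by blast
qed

lemma
  assumes "T \<in> B"
  shows star_BH [simp]: "star T \<in> B"
    and ip_star: "ip (T x) y = ip x (star T y)"
proof -
  have "\<exists>S. S \<in> B \<and> (\<forall>x y. ip (T x) y = ip x (S y))"
    using adjoint_exists[OF assms] by blast
  then have "star T \<in> B \<and> (\<forall>x y. ip (T x) y = ip x (star T y))"
    unfolding adj_def by (rule someI_ex)
  then show "star T \<in> B" "ip (T x) y = ip x (star T y)" by blast+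
qed

lemma star_eqI:
  assumes "T \<in> B" "\<And>x y. ip (T x) y = ip x (S y)"
  shows "star T = S"
  by (rule ext, rule ip_right_eqI) (simp add: assms flip: ip_star)

lemma ip_star': "T \<in> B \<Longrightarrow> ip (star T x) y = ip x (T y)"
  by (metis ip_commute ip_star)

text \<open>Complex polarisation: expanding at \<open>x + y\<close> and at
  \<open>x + sc \<i> y\<close> shows that the sesquilinear difference \<open>q\<close> is both
  antisymmetric and symmetric. Operator identities can thus be tested with functionals that are real
  on self-adjoint operators.\<close>

lemma BH_eqI_quadratic:
  assumes T: "T \<in> B" and S: "S \<in> B" and eq: "\<And>x. ip (T x) x = ip (S x) x"
  shows "T = S"
proof (rule ext, rule ip_left_eqI)
  fix x y
  define q where "q x y = ip (T x) y - ip (S x) y" for x y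
  have 1: "q x x = 0" for x by (simp add: q_def eq)
  have add: "q (x + y) (x + y) = q x x + q x y + q y x + q y y" for x y
    by (simp add: q_def BH_add T S ip_simps)
  have "q x y + q y x = 0" using add[of x y] by (simp add: 1)
  moreover have "q x (sc \<i> y) + q (sc \<i> y) x = 0" using add[of x "sc \<i> y"] by (simp add: 1)
  then have "- \<i> * q x y + \<i> * q y x = 0"
    by (simp add: q_def BH_sc T S ip_simps algebra_simps)
  then have "q y x = q x y" by simp
  ultimately have "q x y = 0" by simp
  then show "ip (T x) y = ip (S x) y" by (simp add: q_def)
qed

text \<open>These are the only functionals with which \<open>\<Delta>\<close> is tested.\<close>

lemma vector_functional_in_dual: "(\<lambda>T. ip (T x) y) \<in> BH_dual sc ip"
proof -
  have "cmod (ip (T x) y) \<le> N x * N y * opnorm ip T" if T: "T \<in> B" for T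
  proof (cases "x = 0")
    case False
    then have x: "N x > 0" using N_eq_0[of x] N_nonneg[of x] by linarith
    obtain K where K: "\<And>x. N (T x) \<le> K * N x" using T BH_bounded by metis
    \<comment> \<open>The real \<open>Sup\<close> in \<open>opnorm\<close> dominates its elements
      only once the set is known to be bounded.\<close>
    have "bdd_above {N (T x) | x. N x \<le> 1}"
    proof (rule bdd_aboveI)
      fix r
      assume "r \<in> {N (T x) | x. N x \<le> 1}"
      then obtain z where "r = N (T z)" "N z \<le> 1" by auto
      moreover have "N (T z) \<le> \<bar>K\<bar> * N z"
        using K[of z] by (meson abs_ge_self mult_right_mono N_nonneg order_trans)
      ultimately show "r \<le> \<bar>K\<bar>"
        using mult_left_mono[of "N z" 1 "\<bar>K\<bar>"] by simp
    qed
    moreover define u where "u = sc (complex_of_real (1 / N x)) x"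
    have "N u \<le> 1" using x by (simp add: u_def N_sc norm_divide)
    ultimately have "N (T u) \<le> opnorm ip T"
      unfolding opnorm_def by (intro cSup_upper) auto
    then have "N (T x) \<le> N x * opnorm ip T"
      using x by (simp add: u_def BH_sc T N_sc norm_divide field_simps)
    then have "N (T x) * N y \<le> N x * opnorm ip T * N y"
      by (rule mult_right_mono) simp
    then show ?thesis
      using cauchy_schwarz[of "T x" y] by (simp add: ac_simps)
  qed (simp add: T)
  then show ?thesis
    unfolding BH_dual_def by (auto simp: ip_simps)
qed

lemma star_opadd: "T \<in> B \<Longrightarrow> S \<in> B \<Longrightarrow> star (T \<oplus> S) = star T \<oplus> star S"
  by (rule star_eqI) (simp_all add: ip_simps ip_star)

lemma star_opscale: "T \<in> B \<Longrightarrow> star (scale a T) = scale (cnj a) (star T)"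
  by (rule star_eqI) (simp_all add: ip_simps ip_star)

lemma star_star: "T \<in> B \<Longrightarrow> star (star T) = T"
  by (rule star_eqI) (simp_all add: ip_star')

lemma self_adjoint_parts:
  assumes T: "T \<in> B"
  obtains a b where "a \<in> B" "b \<in> B" "star a = a" "star b = b" "T = a \<oplus> scale \<i> b"
proof
  \<comment> \<open>The real and imaginary parts of \<open>T\<close>; the factor
    \<open>- \<i>/2\<close> is \<open>1/(2 \<i>)\<close>.\<close>
  let ?a = "scale (1/2) (T \<oplus> star T)" and ?b = "scale (- \<i>/2) (T \<oplus> scale (- 1) (star T))"
  show "?a \<in> B" "?b \<in> B" using T by simp_all
  show "star ?a = ?a" "star ?b = ?b"
    using T by (auto simp: star_opadd star_opscale star_star fun_eq_iff sc_add_right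
        sc_diff_right sc_minus_left add.commute)
  have half: "sc (1/2) (T x) + sc (1/2) (T x) = T x" for x
    by (simp flip: sc_add_left)
  show "T = ?a \<oplus> scale \<i> ?b"
    by (simp add: fun_eq_iff sc_add_right sc_diff_right sc_minus_left sc_minus_right half)
qed

section \<open>Rank-one operators\<close>

text \<open>The operator usually written as the tensor of \<open>u\<close> with the functional of
  \<open>v\<close>; it is conjugate-linear in \<open>v\<close>.\<close>

definition rank1 :: "'h \<Rightarrow> 'h \<Rightarrow> 'h \<Rightarrow> 'h" where
  "rank1 u v x = sc (ip x v) u"

lemma rank1_BH [simp]: "rank1 u v \<in> B"
proof (rule BH_I[where K = "N u * N v"])
  show "N (rank1 u v x) \<le> N u * N v * N x" for x
    using mult_right_mono[OF cauchy_schwarz[of x v] N_nonneg[of u]]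
    by (simp add: rank1_def N_sc ac_simps)
qed (simp_all add: rank1_def ip_simps sc_add_left)

lemma opmult_rank1: "T \<in> B \<Longrightarrow> T \<odot> rank1 u v = rank1 (T u) v"
  by (simp add: fun_eq_iff rank1_def BH_sc)

lemma rank1_opmult: "T \<in> B \<Longrightarrow> rank1 u v \<odot> T = rank1 u (star T v)"
  by (simp add: fun_eq_iff rank1_def ip_star)

definition idem :: "('h \<Rightarrow> 'h) \<Rightarrow> bool" where
  "idem e \<longleftrightarrow> e \<in> B \<and> (\<forall>x. e (e x) = e x)"

text \<open>\<open>rank1 u v\<close> squares to \<open>ip u v\<close> times itself.\<close>

lemma idem_scaled_rank1: "ip u v \<noteq> 0 \<Longrightarrow> idem (scale (1 / ip u v) (rank1 u v))"
  by (simp add: idem_def rank1_def ip_simps)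

lemma rank1_decompose:
  "\<exists>c d e f. idem e \<and> idem f \<and> rank1 u v = scale c e \<oplus> scale d f"
proof -
  have zero: "idem (\<lambda>x. 0)" by (simp add: idem_def)
  consider "ip u v \<noteq> 0" | "u = 0" | "ip u v = 0" "u \<noteq> 0" by blast
  then show ?thesis
  proof cases
    case 1
    have "rank1 u v = scale (ip u v) (scale (1 / ip u v) (rank1 u v)) \<oplus> scale 0 (\<lambda>x. 0)"
      using 1 by (simp add: fun_eq_iff)
    then show ?thesis using idem_scaled_rank1[OF 1] zero by blast
  next
    case 2
    then have "rank1 u v = scale 0 (\<lambda>x. 0) \<oplus> scale 0 (\<lambda>x. 0)"
      by (simp add: fun_eq_iff rank1_def)
    then show ?thesis using zero by blast
  next
    case 3
    then have uu: "ip u u \<noteq> 0" using ip_self_eq_0 by blast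
    then have uv: "ip u (u + v) \<noteq> 0" using 3 by (simp add: ip_add_right)
    \<comment> \<open>A nilpotent \<open>rank1 u v\<close> is written as
      \<open>rank1 u (u + v)\<close> minus \<open>rank1 u u\<close>; both have nonzero square, since
      \<open>ip u (u + v) = ip u u\<close>.\<close>
    have "rank1 u v = scale (ip u (u + v)) (scale (1 / ip u (u + v)) (rank1 u (u + v)))
        \<oplus> scale (- ip u u) (scale (1 / ip u u) (rank1 u u))"
      using uu uv by (simp add: fun_eq_iff rank1_def ip_add_right flip: sc_add_left)
    then show ?thesis using idem_scaled_rank1[OF uu] idem_scaled_rank1[OF uv] by blast
  qed
qed

text \<open>\<open>rank1 x x\<close> maps \<open>x\<close> to a nonzero multiple of itself when
  \<open>x\<close> is nonzero, so the factor on the right can be cancelled.\<close>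

lemma BH_eqI_rank1_right:
  assumes "T \<in> B" "S \<in> B" and eq: "\<And>u v. T \<odot> rank1 u v = S \<odot> rank1 u v"
  shows "T = S"
proof
  fix x
  show "T x = S x"
  proof (cases "x = 0")
    case False
    then have "ip x x \<noteq> 0" using ip_self_eq_0 by blast
    moreover have "sc (ip x x) (T x) = sc (ip x x) (S x)"
      using fun_cong[OF eq, of x x x] assms(1,2) by (simp add: rank1_def BH_sc)
    then have "sc (1 / ip x x) (sc (ip x x) (T x)) = sc (1 / ip x x) (sc (ip x x) (S x))"
      by simp
    ultimately show ?thesis by simp
  qed (simp add: assms)
qed

text \<open>Composing with \<open>rank1 z z\<close> on the left reads off the coefficient
  \<open>ip (T x) z\<close>.\<close>

lemma BH_eqI_rank1_left:
  assumes "\<And>u v. rank1 u v \<odot> T = rank1 u v \<odot> S"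
  shows "T = S"
proof
  fix x
  show "T x = S x"
  proof (rule ip_left_eqI)
    fix z
    have "ip (T x) z * ip z z = ip (S x) z * ip z z"
      using arg_cong[OF fun_cong[OF assms, of z z x], of "\<lambda>y. ip y z"]
      by (simp add: rank1_def ip_simps)
    then show "ip (T x) z = ip (S x) z"
      using ip_self_eq_0[of z] by auto
  qed
qed

end

section \<open>Linearity\<close>

locale weak_2_local = complex_hilbert sc ip
  for sc :: "complex \<Rightarrow> 'h::ab_group_add \<Rightarrow> 'h" and ip +
  fixes \<Delta> :: "('h \<Rightarrow> 'h) \<Rightarrow> ('h \<Rightarrow> 'h)"
  assumes weak_2_local: "weak_2_local_star_derivation sc ip \<Delta>"
begin

lemma \<Delta>_BH [simp]: "T \<in> B \<Longrightarrow> \<Delta> T \<in> B"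
  using weak_2_local unfolding weak_2_local_star_derivation_def by blast

text \<open>\<open>D\<close> varies with \<open>a\<close>, \<open>b\<close>, \<open>x\<close> and
  \<open>y\<close>, so later identities are checked one scalar at a time.\<close>

lemma local_derivation:
  assumes "a \<in> B" "b \<in> B"
  obtains D where "star_derivation sc ip D"
    "ip (\<Delta> a x) y = ip (D a x) y" "ip (\<Delta> b x) y = ip (D b x) y"
  using weak_2_local assms vector_functional_in_dual[of x y]
  unfolding weak_2_local_star_derivation_def by fast

lemma star_derivationD:
  assumes "star_derivation sc ip D" "T \<in> B" "S \<in> B"
  shows "D T \<in> B" "D (T \<oplus> S) = D T \<oplus> D S" "D (scale a T) = scale a (D T)"
    "D (T \<odot> S) = D T \<odot> S \<oplus> T \<odot> D S" "D (star T) = star (D T)"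
  using assms unfolding star_derivation_def linear_on_BH_def by blast+

lemma \<Delta>_scale: "T \<in> B \<Longrightarrow> \<Delta> (scale a T) = scale a (\<Delta> T)"
proof (rule ext, rule ip_left_eqI)
  fix x y
  assume T: "T \<in> B"
  then obtain D where D: "star_derivation sc ip D"
    "ip (\<Delta> T x) y = ip (D T x) y" "ip (\<Delta> (scale a T) x) y = ip (D (scale a T) x) y"
    using local_derivation[of T "scale a T" x y] by auto
  then show "ip (\<Delta> (scale a T) x) y = ip (scale a (\<Delta> T) x) y"
    by (simp add: star_derivationD(3)[OF D(1) T T] ip_simps)
qed

lemma Im_quadratic_self_adjoint:
  assumes "T \<in> B" "star T = T"
  shows "Im (ip (T x) x) = 0"
  using ip_star[OF assms(1), of x x] ip_commute[of x "T x"] assms(2)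
  by (metis Reals_cnj_iff complex_is_Real_iff)

lemma star_\<Delta>_self_adjoint:
  assumes a: "a \<in> B" "star a = a"
  shows "star (\<Delta> a) = \<Delta> a"
proof (rule BH_eqI_quadratic)
  fix x
  obtain D where D: "star_derivation sc ip D" "ip (\<Delta> a x) x = ip (D a x) x"
    using local_derivation[OF a(1) a(1)] by metis
  have "Im (ip (\<Delta> a x) x) = 0"
    unfolding D(2) using star_derivationD[OF D(1) a(1) a(1)] a(2)
    by (intro Im_quadratic_self_adjoint) simp_all
  then have "ip x (\<Delta> a x) = ip (\<Delta> a x) x"
    using ip_commute[of x "\<Delta> a x"] by (simp add: complex_eq_iff)
  then show "ip (star (\<Delta> a) x) x = ip (\<Delta> a x) x"
    by (simp add: ip_star' a)
qed (simp_all add: a)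

text \<open>A \<open>*\<close>-derivation and the functional \<open>\<langle>\<cdot> x, x\<rangle>\<close> take self-adjoint arguments to real numbers, so the
  value at \<open>a + \<i> b\<close> records the values at \<open>a\<close> and \<open>b\<close> separately. Comparing the single point
  \<open>a + \<i> b\<close> with a second point \<open>c\<close> thus compares three points \<open>a\<close>, \<open>b\<close>, \<open>c\<close> at once.\<close>
lemma local_derivation_three_points:
  assumes a: "a \<in> B" "star a = a" and b: "b \<in> B" "star b = b" and c: "c \<in> B"
  obtains D where "star_derivation sc ip D" "ip (\<Delta> a x) x = ip (D a x) x"
    "ip (\<Delta> b x) x = ip (D b x) x" "ip (\<Delta> c x) x = ip (D c x) x"
    "ip (\<Delta> (a \<oplus> scale \<i> b) x) x = ip (\<Delta> a x) x + \<i> * ip (\<Delta> b x) x"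
proof -
  define p where "p = a \<oplus> scale \<i> b"
  have p: "p \<in> B" using a b by (simp add: p_def)
  have Dp: "ip (D p x) x = ip (D a x) x + \<i> * ip (D b x) x"
    and Da: "Im (ip (D a x) x) = 0" and Db: "Im (ip (D b x) x) = 0"
    if "star_derivation sc ip D" for D
    using star_derivationD[OF that a(1) a(1)] star_derivationD[OF that b(1) b(1)]
      star_derivationD(2)[OF that, of a "scale \<i> b"] a b
    by (simp_all add: p_def ip_simps Im_quadratic_self_adjoint)
  obtain D1 where D1: "star_derivation sc ip D1" "ip (\<Delta> p x) x = ip (D1 p x) x"
    "ip (\<Delta> a x) x = ip (D1 a x) x" using local_derivation[OF p a(1)] .
  obtain D2 where D2: "star_derivation sc ip D2" "ip (\<Delta> p x) x = ip (D2 p x) x"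
    "ip (\<Delta> b x) x = ip (D2 b x) x" using local_derivation[OF p b(1)] .
  obtain D where D: "star_derivation sc ip D" "ip (\<Delta> p x) x = ip (D p x) x"
    "ip (\<Delta> c x) x = ip (D c x) x" using local_derivation[OF p c] .
  \<comment> \<open>\<open>D1\<close> and \<open>D\<close> agree at \<open>p\<close>; comparing real
    parts transfers the value at \<open>a\<close> to \<open>D\<close>. Imaginary parts and
    \<open>D2\<close> do the same for \<open>b\<close>.\<close>
  have "ip (\<Delta> a x) x = ip (D a x) x"
    using Dp[OF D1(1)] Da[OF D1(1)] Db[OF D1(1)] D1(2,3)
      Dp[OF D(1)] Da[OF D(1)] Db[OF D(1)] D(2) by (simp add: complex_eq_iff)
  moreover have "ip (\<Delta> b x) x = ip (D b x) x"
    using Dp[OF D2(1)] Da[OF D2(1)] Db[OF D2(1)] D2(2,3)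
      Dp[OF D(1)] Da[OF D(1)] Db[OF D(1)] D(2) by (simp add: complex_eq_iff)
  ultimately show thesis
    using that[OF D(1)] D(2,3) Dp[OF D(1)] unfolding p_def by simp
qed

lemma \<Delta>_complex_combination:
  assumes a: "a \<in> B" "star a = a" and b: "b \<in> B" "star b = b"
  shows "\<Delta> (a \<oplus> scale \<i> b) = \<Delta> a \<oplus> scale \<i> (\<Delta> b)"
proof (rule BH_eqI_quadratic)
  fix x
  show "ip (\<Delta> (a \<oplus> scale \<i> b) x) x = ip ((\<Delta> a \<oplus> scale \<i> (\<Delta> b)) x) x"
    \<comment> \<open>Only the last conclusion is wanted, so \<open>a\<close> merely fills the place
      of the third point.\<close>
    by (rule local_derivation_three_points[OF a b a(1), of x]) (simp add: ip_simps)
qed (simp_all add: a b)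

text \<open>With \<open>a \<oplus> b\<close> as third point, a single additive \<open>D\<close>
  matches \<open>\<Delta>\<close> at both summands and at their sum.\<close>

lemma \<Delta>_add_self_adjoint:
  assumes a: "a \<in> B" "star a = a" and b: "b \<in> B" "star b = b"
  shows "\<Delta> (a \<oplus> b) = \<Delta> a \<oplus> \<Delta> b"
proof (rule BH_eqI_quadratic)
  fix x
  have ab: "a \<oplus> b \<in> B" using a b by simp
  obtain D where D: "star_derivation sc ip D" "ip (\<Delta> a x) x = ip (D a x) x"
    "ip (\<Delta> b x) x = ip (D b x) x" "ip (\<Delta> (a \<oplus> b) x) x = ip (D (a \<oplus> b) x) x"
    using local_derivation_three_points[OF a b ab, of x] by metis
  then show "ip (\<Delta> (a \<oplus> b) x) x = ip ((\<Delta> a \<oplus> \<Delta> b) x) x"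
    using star_derivationD(2)[OF D(1) a(1) b(1)] by (simp add: ip_simps)
qed (simp_all add: a b)

lemma \<Delta>_add:
  assumes T: "T \<in> B" and S: "S \<in> B"
  shows "\<Delta> (T \<oplus> S) = \<Delta> T \<oplus> \<Delta> S"
proof -
  obtain a b where T': "a \<in> B" "b \<in> B" "star a = a" "star b = b" "T = a \<oplus> scale \<i> b"
    using self_adjoint_parts[OF T] .
  obtain c d where S': "c \<in> B" "d \<in> B" "star c = c" "star d = d" "S = c \<oplus> scale \<i> d"
    using self_adjoint_parts[OF S] .
  have "T \<oplus> S = (a \<oplus> c) \<oplus> scale \<i> (b \<oplus> d)"
    by (simp add: T' S' fun_eq_iff sc_add_right ac_simps)
  then show ?thesis
    using T'(1-4) S'(1-4)
    by (simp add: T'(5) S'(5) \<Delta>_complex_combination \<Delta>_add_self_adjoint star_opadd)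
      (simp add: fun_eq_iff sc_add_right ac_simps)
qed

lemma \<Delta>_star:
  assumes T: "T \<in> B"
  shows "\<Delta> (star T) = star (\<Delta> T)"
proof -
  obtain a b where T': "a \<in> B" "b \<in> B" "star a = a" "star b = b" "T = a \<oplus> scale \<i> b"
    using self_adjoint_parts[OF T] .
  then show ?thesis
    by (simp add: star_opadd star_opscale \<Delta>_add \<Delta>_scale star_\<Delta>_self_adjoint)
qed

section \<open>The Leibniz rule\<close>

text \<open>A derivation applied to \<open>e \<odot> a = 0\<close> gives
  \<open>D e \<odot> a \<oplus> e \<odot> D a = 0\<close>, and the first term dies at
  \<open>y\<close>. A vector \<open>y\<close> killed by \<open>a\<close> replaces a right factor
  \<open>f\<close>.\<close>

lemma \<Delta>_zero_product:
  assumes e: "e \<in> B" and a: "a \<in> B" and "\<And>x. e (a x) = 0" and ay: "a y = 0"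
  shows "e (\<Delta> a y) = 0"
proof (rule ip_left_eqI)
  fix z
  obtain D where D: "star_derivation sc ip D" "ip (\<Delta> a y) (star e z) = ip (D a y) (star e z)"
    using local_derivation[OF a a] by metis
  \<comment> \<open>Writing zero as \<open>scale 0 a\<close> lets homogeneity of \<open>D\<close>
    evaluate it.\<close>
  have "e \<odot> a = scale 0 a"
    using assms(3) by (simp add: fun_eq_iff)
  then have "(D e \<odot> a \<oplus> e \<odot> D a) y = scale 0 (D a) y"
    using star_derivationD(3,4)[OF D(1)] e a by metis
  moreover have "D e 0 = 0"
    using star_derivationD(1)[OF D(1) e e] by simp
  ultimately have "e (D a y) = 0"
    using ay by simp
  then show "ip (e (\<Delta> a y)) z = ip 0 z"
    using D(2) by (simp flip: ip_star[OF e])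
qed

lemma \<Delta>_one: "\<Delta> (\<lambda>x. x) = (\<lambda>x. 0)"
proof (rule ext, rule ip_left_eqI)
  fix x y :: 'h
  obtain D where D: "star_derivation sc ip D" "ip (\<Delta> (\<lambda>x. x) x) y = ip (D (\<lambda>x. x) x) y"
    using local_derivation[OF BH_id BH_id] by metis
  have "(\<lambda>x. x) \<odot> (\<lambda>x. x) = (\<lambda>x::'h. x)" by (simp add: fun_eq_iff)
  then have "D (\<lambda>x. x) x = D (\<lambda>x. x) x + D (\<lambda>x. x) x"
    using star_derivationD(4)[OF D(1) BH_id BH_id] by (metis opadd_apply opmult_apply)
  then show "ip (\<Delta> (\<lambda>x. x) x) y = ip 0 y"
    using D(2) by simp
qed

text \<open>The identity is linear in \<open>e\<close> and in \<open>f\<close> separately, so it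
  extends from idempotents to their combinations. For \<open>b\<close> the identity operator it is
  the Leibniz rule, by \<open>\<Delta>_one\<close>.\<close>

definition triple :: "('h \<Rightarrow> 'h) \<Rightarrow> ('h \<Rightarrow> 'h) \<Rightarrow> bool" where
  "triple e f \<longleftrightarrow> (\<forall>b\<in>B. \<forall>x.
     \<Delta> (e \<odot> b \<odot> f) x = \<Delta> (e \<odot> b) (f x) + e (\<Delta> (b \<odot> f) x) - e (\<Delta> b (f x)))"

text \<open>With \<open>k = 1 - e\<close>, both \<open>k \<odot> (e \<odot> g)\<close> and
  \<open>e \<odot> (k \<odot> g)\<close> vanish. Hence \<open>\<Delta> (e \<odot> g) y\<close> lies
  in the range of \<open>e\<close>, and \<open>e\<close> kills the other summand of
  \<open>\<Delta> g y\<close>.\<close>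

lemma \<Delta>_idem_complement:
  assumes e: "idem e" and g: "g \<in> B" and gy: "g y = 0"
  shows "\<Delta> (e \<odot> g) y = e (\<Delta> g y)"
proof -
  have eB: "e \<in> B" and ee: "\<And>x. e (e x) = e x" using e by (auto simp: idem_def)
  define k where "k = (\<lambda>x. x) \<oplus> scale (- 1) e"
  have k: "k \<in> B" and kx: "k x = x - e x" for x
    using eB by (simp_all add: k_def sc_minus_left)
  have "k (\<Delta> (e \<odot> g) y) = 0"
    by (rule \<Delta>_zero_product[of k "e \<odot> g" y]) (simp_all add: k kx eB g ee gy)
  moreover have "e (\<Delta> (k \<odot> g) y) = 0"
    by (rule \<Delta>_zero_product[of e "k \<odot> g" y]) (simp_all add: k kx eB g ee gy BH_diff)
  moreover have "g = e \<odot> g \<oplus> k \<odot> g"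
    by (simp add: fun_eq_iff kx)
  then have "\<Delta> g y = \<Delta> (e \<odot> g) y + \<Delta> (k \<odot> g) y"
    using \<Delta>_add[of "e \<odot> g" "k \<odot> g"] eB k g by (metis BH_opmult opadd_apply)
  ultimately show ?thesis
    by (simp add: kx BH_add eB)
qed

lemma triple_idem:
  assumes e: "idem e" and f: "idem f"
  shows "triple e f"
  unfolding triple_def
proof (intro ballI allI)
  fix b x
  assume b: "b \<in> B"
  have eB: "e \<in> B" and fB: "f \<in> B" and ff: "\<And>x. f (f x) = f x"
    using e f by (auto simp: idem_def)
  \<comment> \<open>\<open>h = b f\<close> kills \<open>x - f x\<close> and
    \<open>g = b - b f\<close> kills \<open>f x\<close>. So \<open>\<Delta>_idem_complement\<close>
    applies to each on its part of \<open>x = (x - f x) + f x\<close>.\<close>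
  define h where "h = b \<odot> f"
  define g where "g = b \<oplus> scale (- 1) h"
  have h: "h \<in> B" and g: "g \<in> B" using b fB by (simp_all add: h_def g_def)
  have "\<Delta> (e \<odot> h) (x - f x) = e (\<Delta> h (x - f x))"
    by (rule \<Delta>_idem_complement[OF e h]) (simp add: h_def BH_diff fB ff b)
  then have 1: "\<Delta> (e \<odot> h) x = \<Delta> (e \<odot> h) (f x) + (e (\<Delta> h x) - e (\<Delta> h (f x)))"
    using eB h by (simp add: BH_diff algebra_simps)
  have "\<Delta> (e \<odot> g) (f x) = e (\<Delta> g (f x))"
    by (rule \<Delta>_idem_complement[OF e g]) (simp add: g_def h_def ff sc_minus_left)
  moreover have "e \<odot> g = e \<odot> b \<oplus> scale (- 1) (e \<odot> h)"
    by (simp add: g_def fun_eq_iff BH_add BH_sc eB)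
  ultimately have 2: "\<Delta> (e \<odot> h) (f x) = \<Delta> (e \<odot> b) (f x) - (e (\<Delta> b (f x)) - e (\<Delta> h (f x)))"
    using b eB h unfolding g_def
    by (simp add: \<Delta>_add \<Delta>_scale BH_diff sc_minus_left algebra_simps)
  have "e \<odot> b \<odot> f = e \<odot> h"
    by (simp add: h_def fun_eq_iff)
  then show "\<Delta> (e \<odot> b \<odot> f) x
      = \<Delta> (e \<odot> b) (f x) + e (\<Delta> (b \<odot> f) x) - e (\<Delta> b (f x))"
    by (simp add: 1 2 flip: h_def)
qed

section \<open>Extension from idempotents to rank-one operators\<close>

lemma triple_combination_left:
  assumes "triple e f" "triple e' f" "e \<in> B" "e' \<in> B" "f \<in> B"
  shows "triple (scale c e \<oplus> scale d e') f"
  unfolding triple_def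
proof (intro ballI allI)
  fix b x
  assume b: "b \<in> B"
  have 1: "(scale c e \<oplus> scale d e') \<odot> T = scale c (e \<odot> T) \<oplus> scale d (e' \<odot> T)" for T
    by (simp add: fun_eq_iff)
  have 2: "(S \<oplus> T) \<odot> f = S \<odot> f \<oplus> T \<odot> f" "scale a S \<odot> f = scale a (S \<odot> f)" for a S T
    by (simp_all add: fun_eq_iff)
  show "\<Delta> ((scale c e \<oplus> scale d e') \<odot> b \<odot> f) x
    = \<Delta> ((scale c e \<oplus> scale d e') \<odot> b) (f x)
      + (scale c e \<oplus> scale d e') (\<Delta> (b \<odot> f) x) - (scale c e \<oplus> scale d e') (\<Delta> b (f x))"
    using assms b unfolding triple_def
    by (simp add: 1 2 \<Delta>_add \<Delta>_scale sc_add_right sc_diff_right)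
qed

lemma triple_combination_right:
  assumes "triple e f" "triple e f'" "e \<in> B" "f \<in> B" "f' \<in> B"
  shows "triple e (scale c f \<oplus> scale d f')"
  unfolding triple_def
proof (intro ballI allI)
  fix b x
  assume b: "b \<in> B"
  have 1: "T \<odot> (scale c f \<oplus> scale d f') = scale c (T \<odot> f) \<oplus> scale d (T \<odot> f')"
    if "T \<in> B" for T
    using that by (simp add: fun_eq_iff BH_add BH_sc)
  show "\<Delta> (e \<odot> b \<odot> (scale c f \<oplus> scale d f')) x
    = \<Delta> (e \<odot> b) ((scale c f \<oplus> scale d f') x)
      + e (\<Delta> (b \<odot> (scale c f \<oplus> scale d f')) x) - e (\<Delta> b ((scale c f \<oplus> scale d f') x))"
    using assms b unfolding triple_def
    by (simp add: 1 \<Delta>_add \<Delta>_scale sc_add_right sc_diff_right BH_add BH_sc)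
qed

lemma triple_rank1: "triple (rank1 u v) (rank1 w z)"
proof -
  obtain c d e f where e: "idem e" "idem f" "rank1 u v = scale c e \<oplus> scale d f"
    using rank1_decompose by blast
  obtain c' d' e' f' where f: "idem e'" "idem f'" "rank1 w z = scale c' e' \<oplus> scale d' f'"
    using rank1_decompose by blast
  have idem_BH: "idem p \<Longrightarrow> p \<in> B" for p by (simp add: idem_def)
  show ?thesis unfolding e f
    using e(1,2) f(1,2)
    by (intro triple_combination_left triple_combination_right triple_idem)
      (simp_all add: idem_BH)
qed

section \<open>From rank-one operators to all bounded operators\<close>

lemma \<Delta>_rank1_mult_rank1:
  "\<Delta> (rank1 u v \<odot> rank1 w z) = \<Delta> (rank1 u v) \<odot> rank1 w z \<oplus> rank1 u v \<odot> \<Delta> (rank1 w z)"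
proof
  fix x
  have "rank1 u v \<odot> (\<lambda>x. x) = rank1 u v" "(\<lambda>x. x) \<odot> rank1 w z = rank1 w z"
    by (simp_all add: fun_eq_iff)
  then show "\<Delta> (rank1 u v \<odot> rank1 w z) x
      = (\<Delta> (rank1 u v) \<odot> rank1 w z \<oplus> rank1 u v \<odot> \<Delta> (rank1 w z)) x"
    using triple_rank1[of u v w z, unfolded triple_def, rule_format, OF BH_id, of x]
    by (simp add: \<Delta>_one)
qed

text \<open>Expand \<open>\<Delta>\<close> at \<open>e b f\<close> by \<open>triple_rank1\<close>
  and, \<open>b f\<close> being of rank one, by the previous lemma. The terms
  \<open>e \<Delta>(b f)\<close> cancel, and then the arbitrary right factor \<open>f\<close>
  does.\<close>

lemma \<Delta>_rank1_mult:
  assumes b: "b \<in> B"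
  shows "\<Delta> (rank1 u v \<odot> b) = \<Delta> (rank1 u v) \<odot> b \<oplus> rank1 u v \<odot> \<Delta> b"
proof (rule BH_eqI_rank1_right)
  fix w z
  let ?e = "rank1 u v" and ?f = "rank1 w z"
  show "\<Delta> (?e \<odot> b) \<odot> ?f = (\<Delta> ?e \<odot> b \<oplus> ?e \<odot> \<Delta> b) \<odot> ?f"
  proof
    fix x
    have "\<Delta> (?e \<odot> (b \<odot> ?f)) = \<Delta> ?e \<odot> (b \<odot> ?f) \<oplus> ?e \<odot> \<Delta> (b \<odot> ?f)"
      unfolding opmult_rank1[OF b] by (rule \<Delta>_rank1_mult_rank1)
    moreover have "?e \<odot> b \<odot> ?f = ?e \<odot> (b \<odot> ?f)"
      by (simp add: fun_eq_iff)
    ultimately show "(\<Delta> (?e \<odot> b) \<odot> ?f) x = ((\<Delta> ?e \<odot> b \<oplus> ?e \<odot> \<Delta> b) \<odot> ?f) x"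
      using triple_rank1[of u v w z, unfolded triple_def, rule_format, OF b, of x]
      by (simp add: algebra_simps)
  qed
qed (simp_all add: b)

text \<open>Since \<open>e a\<close> is again of rank one, \<open>\<Delta>_rank1_mult\<close>
  expands both \<open>(e a) b\<close> and \<open>e (a b)\<close>; comparing them allows
  \<open>e\<close> to be cancelled on the left.\<close>

lemma \<Delta>_mult:
  assumes a: "a \<in> B" and b: "b \<in> B"
  shows "\<Delta> (a \<odot> b) = \<Delta> a \<odot> b \<oplus> a \<odot> \<Delta> b"
proof (rule BH_eqI_rank1_left)
  fix u v
  let ?e = "rank1 u v"
  have "\<Delta> (?e \<odot> a \<odot> b) = \<Delta> (?e \<odot> a) \<odot> b \<oplus> ?e \<odot> a \<odot> \<Delta> b"
    unfolding rank1_opmult[OF a] by (rule \<Delta>_rank1_mult[OF b])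
  moreover have "\<Delta> (?e \<odot> (a \<odot> b)) = \<Delta> ?e \<odot> (a \<odot> b) \<oplus> ?e \<odot> \<Delta> (a \<odot> b)"
    using a b by (intro \<Delta>_rank1_mult) simp
  moreover have "?e \<odot> a \<odot> b = ?e \<odot> (a \<odot> b)"
    by (simp add: fun_eq_iff)
  ultimately show "?e \<odot> \<Delta> (a \<odot> b) = ?e \<odot> (\<Delta> a \<odot> b \<oplus> a \<odot> \<Delta> b)"
    by (simp add: fun_eq_iff \<Delta>_rank1_mult[OF a] BH_add algebra_simps)
qed

lemma \<Delta>_star_derivation: "linear_on_BH sc ip \<Delta> \<and> star_derivation sc ip \<Delta>"
  unfolding star_derivation_def linear_on_BH_def
  by (auto simp: \<Delta>_add \<Delta>_scale \<Delta>_mult \<Delta>_star)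

end

theorem theorem3p10:
  fixes sc :: "complex \<Rightarrow> 'h::ab_group_add \<Rightarrow> 'h"
    and ip :: "'h \<Rightarrow> 'h \<Rightarrow> complex"
    and \<Delta> :: "('h \<Rightarrow> 'h) \<Rightarrow> ('h \<Rightarrow> 'h)"
  assumes "complex_hilbert_space sc ip"
    and "hseparable ip"
    and "weak_2_local_star_derivation sc ip \<Delta>"
  shows "linear_on_BH sc ip \<Delta> \<and> star_derivation sc ip \<Delta>"
proof -
  interpret weak_2_local sc ip \<Delta>
    using assms by unfold_locales
  show ?thesis by (rule \<Delta>_star_derivation)
qed

end
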